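(* Let $M$ be a finite loopless matroid with ground set $E$ and rank function $r$, let $\omega:E\to\mathbb{Q}^+$ be a weight function, and let $d$ be a positive rational number. There exists a mapping $\phi:E\to S_d$ such that for every point $x\in S_d$ the set $E_\phi(x)=\{\,e\in E\mid x\in[\,\phi(e),\,\phi(e)+\omega(e)\,)\,\}$ is independent in $M$ if and only if for every non-empty $A\subseteq E$ we have $d\ge \omega(A)/r(A)$, where $\omega(A)=\sum_{a\in A}\omega(a)$.
   Context: $\mathbb{Q}^+$ denotes the non-negative rationals. $S_d$ is the circle of circumference $d$, i.e. $\mathbb{R}/d\mathbb{R}$. For $x,y\in S_d$, the (left-closed, right-open) cyclic interval $[x,y)$ is the part of $S_d$ starting at $x$ and following the circle in the positive direction until reaching $y$; thus $[\phi(e),\phi(e)+\omega(e))$ is the arc of length $\omega(e)$ starting at $\phi(e)$ (taken modulo $d$).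
   Formalization: The existence side also requires ω(e) ≤ d for every e in E, so that an arc of length ω(e) exists in S_d; without it the equivalence fails, e.g. for a single non-loop element with ω = 2 and d = 1, where the wrapped arc is all of S_d. *)

theory Defs
  imports "HOL-Analysis.Analysis" "HOL-Library.Real_Mod"
begin

locale matroid =
  fixes E :: "'a set" and indep :: "'a set \<Rightarrow> bool"
  assumes finite_ground: "finite E"
    and indep_subset_ground: "indep I \<Longrightarrow> I \<subseteq> E"
    and indep_empty: "indep {}"
    and indep_mono: "indep J \<Longrightarrow> I \<subseteq> J \<Longrightarrow> indep I"
    and augment: "indep I \<Longrightarrow> indep J \<Longrightarrow> card I < card J
      \<Longrightarrow> \<exists>e\<in>J - I. indep (insert e I)"

definition loopless :: "'a set \<Rightarrow> ('a set \<Rightarrow> bool) \<Rightarrow> bool" where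
  "loopless E indep \<longleftrightarrow> (\<forall>e\<in>E. indep {e})"

text \<open>Intended for finite \<open>A\<close>, so that the maximum is taken over a finite non-empty set.\<close>

definition matroid_rank :: "('a set \<Rightarrow> bool) \<Rightarrow> 'a set \<Rightarrow> nat" where
  "matroid_rank indep A = Max (card ` {I. I \<subseteq> A \<and> indep I})"

text \<open>The points of the circle of circumference \<open>d\<close> are the cosets of \<open>d\<int>\<close> in \<open>\<real>\<close>.\<close>

definition circle :: "real \<Rightarrow> real set set" where
  "circle d = UNIV // {(u, v). [u = v] (rmod d)}"

text \<open>
  \<open>cyclic_arc d p l\<close> is the image in \<open>circle d\<close> of a half-open real interval \<open>[u, u + l)\<close>, where
  \<open>u\<close> is a representative of the point \<open>p\<close>. Taking the length rather than the end point as an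
  argument keeps the empty arc (\<open>l = 0\<close>) apart from the full circle (\<open>l = d\<close>). If \<open>l > d\<close>, the
  interval wraps around and overlaps itself: the image is then the full circle, which is not an
  arc of length \<open>l\<close>.
\<close>

definition cyclic_arc :: "real \<Rightarrow> real set \<Rightarrow> real \<Rightarrow> real set set" where
  "cyclic_arc d p l = {q \<in> circle d. \<exists>u\<in>p. \<exists>v\<in>q. u \<le> v \<and> v < u + l}"

definition active_elements ::
    "'a set \<Rightarrow> ('a \<Rightarrow> rat) \<Rightarrow> rat \<Rightarrow> ('a \<Rightarrow> real set) \<Rightarrow> real set \<Rightarrow> 'a set" where
  "active_elements E \<omega> d \<phi> x =
     {e \<in> E. x \<in> cyclic_arc (of_rat d) (\<phi> e) (of_rat (\<omega> e))}"

end

(*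
For sufficiency, scale to integers and add the weights one unit at a time. If the missing last
unit of an arc cannot be added at a point, it can be exchanged for the first unit of another arc
starting at this point, and the arc that lost its first unit is shifted by one. Suppose this goes
on forever, and consider the set A of arcs that are moved infinitely often. No exchange circuit
meets the complement of A, so at every point the arcs of A present there span A. Counting over
all d points gives w(A) - 1 >= d r(A), a contradiction.

For necessity, integrate the inequality |E(x) Int A| <= r(A) over the circle.
*)

theory Submission
  imports Defs
begin

text \<open>\<open>step\<close> is a relation that admits every legal exchange, and
  \<open>moved s\<close> collects what any sequence of exchanges can make incomplete. "Moved
  infinitely often" becomes membership in \<open>moved\<close> at a state from which this set cannot
  shrink. So an unmoved element that starts at a reachable tip is never exchangeable there:
  exchanging it would itself be a step. The remaining obstacle is an unmoved arc that the tip meets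
  in its interior. It might lie on an exchange circuit although no step may remove it. Such arcs are
  excluded point by point from their start onwards, because the span of a layer at a fixed point,
  suitably restricted, is the same at all times.\<close>

section \<open>Offsets on the discrete circle\<close>

lemma mod_diff_eq_iff:
  fixes x c k D :: int
  assumes "0 \<le> k" "k < D"
  shows "(x - c) mod D = k \<longleftrightarrow> x mod D = (c + k) mod D"
proof -
  have "(x - c) mod D = k \<longleftrightarrow> (x - c) mod D = k mod D"
    using assms by simp
  also have "\<dots> \<longleftrightarrow> x mod D = (c + k) mod D"
    by (simp add: mod_eq_dvd_iff algebra_simps)
  finally show ?thesis .
qed

text \<open>It serves both to advance a start and to move the point back by one, since
  \<open>x - (c + 1)\<close> is also \<open>(x - 1) - c\<close>.\<close>

lemma mod_diff_Suc:
  fixes x c D :: int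
  assumes "D > 0"
  shows "(x - (c + 1)) mod D = (if (x - c) mod D = 0 then D - 1 else (x - c) mod D - 1)"
proof -
  define m where "m = (x - c) mod D"
  have m: "0 \<le> m" "m < D"
    using assms by (auto simp: m_def)
  have "(x - (c + 1)) mod D = (m - 1) mod D"
    unfolding m_def by (metis diff_diff_eq mod_diff_left_eq)
  also have "\<dots> = (if m = 0 then D - 1 else m - 1)"
    using m by (auto simp: zmod_minus1)
  finally show ?thesis
    by (simp add: m_def)
qed

lemma card_residues_le:
  fixes c D w :: int
  assumes "D > 0" "0 \<le> w"
  shows "int (card {x \<in> {0..<D}. (x - c) mod D < w}) \<le> w"
proof -
  have "{x \<in> {0..<D}. (x - c) mod D < w} \<subseteq> (\<lambda>j. (c + j) mod D) ` {0..<w}"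
  proof
    fix x assume "x \<in> {x \<in> {0..<D}. (x - c) mod D < w}"
    then have x: "0 \<le> x" "x < D" "(x - c) mod D < w" by auto
    have "x = (c + (x - c) mod D) mod D"
      using x by (simp add: mod_simps)
    moreover have "(x - c) mod D \<in> {0..<w}"
      using x assms by simp
    ultimately show "x \<in> (\<lambda>j. (c + j) mod D) ` {0..<w}"
      by blast
  qed
  then have "card {x \<in> {0..<D}. (x - c) mod D < w} \<le> card {0..<w}"
    by (meson card_image_le card_mono finite_atLeastLessThan_int finite_imageI le_trans)
  then show ?thesis using assms by simp
qed

section \<open>Spans, exchanges and fundamental circuits\<close>

context matroid
begin

lemma finite_indep: "indep I \<Longrightarrow> finite I"
  using indep_subset_ground finite_ground finite_subset by blast

lemma extend_indep:
  assumes "indep I" "indep J"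
  obtains K where "I \<subseteq> K" "K \<subseteq> I \<union> J" "indep K" "card J \<le> card K"
proof -
  have "\<exists>K. I \<subseteq> K \<and> K \<subseteq> I \<union> J \<and> indep K \<and> card J \<le> card K"
    using assms(1)
  proof (induction "card J - card I" arbitrary: I)
    case 0
    then show ?case by (intro exI[of _ I]) auto
  next
    case (Suc n)
    then have "card I < card J" by simp
    then obtain e where e: "e \<in> J - I" "indep (insert e I)"
      using augment Suc.prems assms(2) by blast
    then have "n = card J - card (insert e I)"
      using Suc.hyps(2) Suc.prems finite_indep by simp
    then show ?case
      using Suc.hyps(1)[of "insert e I"] e by blast
  qed
  then show thesis using that by blast
qed

text \<open>This is the usual closure for independent \<open>I\<close> only; a dependent
  \<open>I\<close> would give all of \<open>E\<close>.\<close>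

definition matroid_span :: "'a set \<Rightarrow> 'a set" where
  "matroid_span I = {e \<in> E. e \<in> I \<or> \<not> indep (insert e I)}"

lemma subset_span: "indep I \<Longrightarrow> I \<subseteq> matroid_span I"
  using indep_subset_ground by (auto simp: matroid_span_def)

lemma card_le_card_of_subset_span:
  assumes "indep K" "indep J" "J \<subseteq> matroid_span K"
  shows "card J \<le> card K"
proof (rule ccontr)
  assume "\<not> card J \<le> card K"
  then obtain e where "e \<in> J - K" "indep (insert e K)"
    using augment assms by (meson not_le)
  then show False using assms(3) by (auto simp: matroid_span_def)
qed

text \<open>If \<open>e\<close> were a counterexample, extend \<open>I\<close> within
  \<open>I\<close>, \<open>K\<close> and \<open>e\<close> to more than \<open>card K\<close>
  elements. The extension avoids \<open>e\<close>, which depends on \<open>I\<close>, so it is an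
  independent subset of the span of \<open>K\<close> that is larger than \<open>K\<close>.\<close>

lemma span_subset_span:
  assumes "indep K" "indep I" "I \<subseteq> matroid_span K"
  shows "matroid_span I \<subseteq> matroid_span K"
proof
  fix e assume e: "e \<in> matroid_span I"
  show "e \<in> matroid_span K"
  proof (rule ccontr)
    assume eK: "e \<notin> matroid_span K"
    then have *: "indep (insert e K)" "e \<notin> K" "e \<notin> I" "\<not> indep (insert e I)"
      using e assms(3) by (auto simp: matroid_span_def)
    obtain J where J: "I \<subseteq> J" "J \<subseteq> I \<union> insert e K" "indep J" "card (insert e K) \<le> card J"
      using extend_indep[OF assms(2) *(1)] by metis
    have "e \<notin> J"
      using J(1,3) *(4) indep_mono by blast
    then have "J \<subseteq> matroid_span K"
      using J(2) assms(3) subset_span[OF assms(1)] by blast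
    then have "card J \<le> card K"
      using card_le_card_of_subset_span assms(1) J(3) by blast
    then show False
      using J(4) *(2) finite_indep[OF assms(1)] by simp
  qed
qed

text \<open>Each set lies in the span of the other: returning \<open>f\<close> restores the
  dependent set \<open>insert p I\<close>.\<close>

lemma span_exchange:
  assumes "indep I" "p \<in> E" "\<not> indep (insert p I)" "f \<in> insert p I" "indep (insert p I - {f})"
  shows "matroid_span (insert p I - {f}) = matroid_span I"
proof -
  have "p \<in> matroid_span I" using assms by (simp add: matroid_span_def)
  then have "insert p I - {f} \<subseteq> matroid_span I"
    using subset_span[OF assms(1)] by blast
  moreover have "I \<subseteq> matroid_span (insert p I - {f})"
  proof
    fix e assume "e \<in> I"
    moreover have "insert f (insert p I - {f}) = insert p I"
      using assms(4) by blast
    ultimately show "e \<in> matroid_span (insert p I - {f})"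
      using assms(3) indep_subset_ground[OF assms(1)] by (cases "e = f") (auto simp: matroid_span_def)
  qed
  ultimately show ?thesis
    using span_subset_span assms(1,5) by blast
qed

text \<open>Take a minimal dependent \<open>C\<close>. Extend \<open>C - {f}\<close> by elements of
  \<open>I\<close> to the size of \<open>I\<close>: \<open>f\<close> cannot come back, since that
  would complete \<open>C\<close>, so by cardinality the extension is all of
  \<open>insert p I - {f}\<close>.\<close>

lemma fundamental_circuit:
  assumes "indep I" "\<not> indep (insert p I)"
  obtains C where "C \<subseteq> insert p I" "\<not> indep C"
    "\<And>f. f \<in> C \<Longrightarrow> indep (C - {f})" "\<And>f. f \<in> C \<Longrightarrow> indep (insert p I - {f})"
proof -
  have fin: "finite (insert p I)" using finite_indep assms(1) by simp
  obtain C where C: "C \<subseteq> insert p I" "\<not> indep C"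
    and min: "\<And>B. B \<subseteq> C \<Longrightarrow> B \<noteq> C \<Longrightarrow> indep B"
  proof -
    let ?S = "{C. C \<subseteq> insert p I \<and> \<not> indep C}"
    have "finite ?S" "?S \<noteq> {}" using fin assms(2) by auto
    then obtain C where "C \<in> ?S" "\<forall>B\<in>?S. B \<subseteq> C \<longrightarrow> C = B"
      using finite_has_minimal[of ?S] by blast
    then show thesis by (intro that[of C]) auto
  qed
  have cmin: "indep (C - {f})" if "f \<in> C" for f
    using min that by blast
  moreover have "indep (insert p I - {f})" if f: "f \<in> C" for f
  proof -
    obtain K where K: "C - {f} \<subseteq> K" "K \<subseteq> (C - {f}) \<union> I" "indep K" "card I \<le> card K"
      using extend_indep[OF cmin[OF f] assms(1)] by metis
    have "f \<notin> K" using K(1,3) C(2) indep_mono by blast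
    then have sub: "K \<subseteq> insert p I - {f}" using K(2) C(1) by blast
    moreover have "p \<notin> I" using assms by (auto simp: insert_absorb)
    then have "card (insert p I - {f}) \<le> card K"
      using K(4) f C(1) fin by (simp add: card_Diff_singleton_if subset_iff)
    ultimately have "K = insert p I - {f}"
      using fin by (meson card_seteq finite_Diff)
    then show ?thesis using K(3) by simp
  qed
  ultimately show thesis using that C by blast
qed

lemma card_le_rank:
  assumes "indep I" "I \<subseteq> A" "finite A"
  shows "card I \<le> matroid_rank indep A"
  unfolding matroid_rank_def using assms by (intro Max_ge) auto

lemma rank_attained:
  assumes "finite A"
  obtains I where "I \<subseteq> A" "indep I" "card I = matroid_rank indep A"
proof -
  have "matroid_rank indep A \<in> card ` {I. I \<subseteq> A \<and> indep I}"
    unfolding matroid_rank_def using assms indep_empty by (intro Max_in) auto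
  then show thesis using that by auto
qed

lemma rank_singleton_le: "matroid_rank indep {e} \<le> 1"
proof -
  obtain I where "I \<subseteq> {e}" "card I = matroid_rank indep {e}"
    using rank_attained[of "{e}"] by auto
  then show ?thesis using card_mono[of "{e}" I] by simp
qed

end

section \<open>Pushing arcs around the circle\<close>

locale weighted_matroid = matroid +
  fixes w :: "'a \<Rightarrow> int" and D :: int
  assumes D_pos: "D > 0"
    and w_nonneg: "e \<in> E \<Longrightarrow> 0 \<le> w e"
    and weight_le_rank: "A \<subseteq> E \<Longrightarrow> sum w A \<le> D * int (matroid_rank indep A)"
begin

lemma w_le_D:
  assumes "e \<in> E"
  shows "w e \<le> D"
proof -
  have "D * int (matroid_rank indep {e}) \<le> D * 1"
    using D_pos rank_singleton_le by (intro mult_left_mono) auto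
  then show ?thesis using weight_le_rank[of "{e}"] assms by simp
qed

text \<open>A state \<open>(\<phi>, p)\<close> places the weights on \<open>\<int>/D\<int>\<close>, except that the arc of \<open>p\<close> still lacks its
  last unit, which would sit at the point \<open>tip\<close>. A step supplies this unit and instead removes
  from the tip the first unit of an arc starting there; the arc that lost it is shifted by
  one and becomes the incomplete one. Starting points are kept as unreduced integers, so that
  a shift always increases them.\<close>

definition layer :: "('a \<Rightarrow> int) \<times> 'a \<Rightarrow> int \<Rightarrow> 'a set" where
  "layer s x = {e \<in> E. (x - fst s e) mod D < (if e = snd s then w e - 1 else w e)}"

definition tip :: "('a \<Rightarrow> int) \<times> 'a \<Rightarrow> int" where
  "tip s = fst s (snd s) + (w (snd s) - 1)"

definition state :: "('a \<Rightarrow> int) \<times> 'a \<Rightarrow> bool" where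
  "state s \<longleftrightarrow> snd s \<in> E \<and> 1 \<le> w (snd s) \<and> (\<forall>x. indep (layer s x))"

inductive step :: "('a \<Rightarrow> int) \<times> 'a \<Rightarrow> ('a \<Rightarrow> int) \<times> 'a \<Rightarrow> bool" where
  "f \<in> insert (snd s) (layer s (tip s)) \<Longrightarrow> fst s f mod D = tip s mod D \<Longrightarrow>
   indep (insert (snd s) (layer s (tip s)) - {f}) \<Longrightarrow> step s ((fst s)(f := fst s f + 1), f)"

lemma layer_cong:
  assumes "x mod D = y mod D"
  shows "layer s x = layer s y"
proof -
  have "(x - c) mod D = (y - c) mod D" for c
    using assms by (metis mod_diff_left_eq)
  then show ?thesis by (simp add: layer_def)
qed

lemma at_tip_iff:
  assumes "state s"
  shows "(x - fst s (snd s)) mod D = w (snd s) - 1 \<longleftrightarrow> x mod D = tip s mod D"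
  unfolding tip_def using assms w_le_D by (intro mod_diff_eq_iff) (force simp: state_def)+

lemma tip_notin_layer: "state s \<Longrightarrow> snd s \<notin> layer s (tip s)"
  using at_tip_iff[of s "tip s"] by (simp add: layer_def)

lemma full_layer:
  assumes "state s"
  shows "{e \<in> E. (x - fst s e) mod D < w e} =
    (if x mod D = tip s mod D then insert (snd s) (layer s x) else layer s x)"
  using at_tip_iff[OF assms, of x] assms by (auto simp: layer_def state_def)

text \<open>The arc of \<open>f\<close> starts one later and lacks its last unit, so its far end
  stays in place and only its first point is given up. That point is the tip, where
  \<open>snd s\<close> gains its missing unit.\<close>

lemma layer_step:
  assumes s: "state s" and st: "step s t"
  shows "layer t x =
    (if x mod D = tip s mod D then insert (snd s) (layer s x) - {snd t} else layer s x)"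
proof -
  obtain f where t: "t = ((fst s)(f := fst s f + 1), f)"
    and f: "f \<in> insert (snd s) (layer s (tip s))" "fst s f mod D = tip s mod D"
    using st by (cases rule: step.cases) auto
  have fE: "f \<in> E" using f(1) s by (auto simp: layer_def state_def)
  then have wf: "0 \<le> w f" "w f \<le> D" using w_nonneg w_le_D by auto
  have f0: "(x - fst s f) mod D = 0 \<longleftrightarrow> x mod D = tip s mod D"
    using mod_diff_eq_iff[of 0 D x "fst s f"] D_pos f(2) by simp
  \<comment> \<open>At the old start the offset wraps to \<open>D - 1\<close>, which
    \<open>w f <= D\<close> keeps outside the shortened arc.\<close>
  have ff: "f \<in> layer t x \<longleftrightarrow> (x - fst s f) mod D \<noteq> 0 \<and> (x - fst s f) mod D < w f"
    using wf fE mod_diff_Suc[OF D_pos, of x "fst s f"] by (auto simp: layer_def t)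
  have "e \<in> layer t x \<longleftrightarrow> e \<in> (if x mod D = tip s mod D then insert (snd s) (layer s x) - {snd t} else layer s x)" for e
  proof (cases "e = f")
    case True
    show ?thesis
    proof (cases "f = snd s")
      \<comment> \<open>An incomplete arc whose tip is its own start has weight 1. It occupies no
        point, and the step merely moves it on.\<close>
      case fs: True
      then have "(tip s - fst s f) mod D = w f - 1"
        using at_tip_iff[OF s, of "tip s"] by simp
      moreover have "(tip s - fst s f) mod D = 0"
        using mod_diff_eq_iff[of 0 D "tip s" "fst s f"] D_pos f(2) by simp
      ultimately have "w f = 1" by simp
      have "\<not> (x - fst s f) mod D < 0" using D_pos by (simp add: not_less)
      then show ?thesis
        using ff True fs f0 \<open>w f = 1\<close> by (auto simp: t layer_def)
    next
      case False
      then show ?thesis using ff True f0 fE by (auto simp: t layer_def)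
    qed
  next
    case False
    have "e \<in> layer t x \<longleftrightarrow> e \<in> {e \<in> E. (x - fst s e) mod D < w e}"
      using False by (simp add: layer_def t)
    also have "\<dots> \<longleftrightarrow> e \<in> (if x mod D = tip s mod D then insert (snd s) (layer s x) else layer s x)"
      using full_layer[OF s, of x] by simp
    finally show ?thesis using False by (auto simp: t)
  qed
  then show ?thesis by blast
qed

lemma step_elim:
  assumes "state s" "step s t"
  shows "snd t \<in> insert (snd s) (layer s (tip s))"
    and "indep (insert (snd s) (layer s (tip s)) - {snd t})"
    and "fst t = (fst s)(snd t := fst s (snd t) + 1)"
  using assms by (auto elim: step.cases)

lemma state_step:
  assumes s: "state s" and st: "step s t"
  shows "state t"
proof -
  have "snd t \<in> E" "1 \<le> w (snd t)"
  proof -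
    have "\<And>y. 0 \<le> y mod D" using D_pos by simp
    then show "snd t \<in> E" "1 \<le> w (snd t)"
      using step_elim(1)[OF assms] s unfolding layer_def state_def
      by (auto split: if_splits) (smt (verit))
  qed
  moreover have "indep (layer t x)" for x
    using layer_step[OF assms, of x] step_elim(2)[OF assms] s layer_cong[of x "tip s" s]
    by (auto simp: state_def)
  ultimately show ?thesis by (simp add: state_def)
qed

lemma state_steps: "step\<^sup>*\<^sup>* s t \<Longrightarrow> state s \<Longrightarrow> state t"
  by (induction rule: rtranclp_induct) (auto intro: state_step)

text \<open>A shifted arc becomes the incomplete one, so \<open>snd t\<close> records the latest
  shift; \<open>snd s\<close> itself is included.\<close>

definition moved :: "('a \<Rightarrow> int) \<times> 'a \<Rightarrow> 'a set" where
  "moved s = {snd t |t. step\<^sup>*\<^sup>* s t}"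

lemma moved_mono: "step\<^sup>*\<^sup>* s t \<Longrightarrow> moved t \<subseteq> moved s"
  by (auto simp: moved_def intro: rtranclp_trans)

lemma moved_subset: "state s \<Longrightarrow> moved s \<subseteq> E"
  using state_steps unfolding moved_def state_def by blast

text \<open>\<open>moved\<close> only shrinks along steps, so a reachable state where it has least
  cardinality keeps it constant.\<close>

lemma exists_recurrent:
  assumes "state s"
  obtains t where "state t" "\<And>u. step\<^sup>*\<^sup>* t u \<Longrightarrow> moved u = moved t"
proof -
  obtain t where t: "step\<^sup>*\<^sup>* s t" "\<And>u. step\<^sup>*\<^sup>* s u \<Longrightarrow> card (moved t) \<le> card (moved u)"
    using ex_has_least_nat[of "step\<^sup>*\<^sup>* s" s "\<lambda>u. card (moved u)"] by auto
  have "moved u = moved t" if "step\<^sup>*\<^sup>* t u" for u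
  proof (rule card_seteq)
    show "finite (moved t)"
      using moved_subset state_steps[OF t(1) assms] finite_ground finite_subset by blast
    show "moved u \<subseteq> moved t" using moved_mono that by blast
    show "card (moved t) \<le> card (moved u)"
      using t that by (meson rtranclp_trans)
  qed
  then show thesis using that state_steps[OF t(1) assms] by blast
qed

text \<open>A start grows by one at a time, so it cannot leave its value without a state in which
  \<open>a\<close> has just been shifted once.\<close>

lemma start_steps:
  assumes "step\<^sup>*\<^sup>* s t" "state s"
  shows "fst t a = fst s a \<or>
    (\<exists>u. step\<^sup>*\<^sup>* s u \<and> snd u = a \<and> fst u a = fst s a + 1)"
  using assms
proof (induction rule: rtranclp_induct)
  case (step t u)
  then have "state t" using state_steps by blast
  then have u: "fst u = (fst t)(snd u := fst t (snd u) + 1)"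
    using step_elim(3) step.hyps(2) by blast
  have "step\<^sup>*\<^sup>* s u" using step.hyps by simp
  then show ?case
    using u step.IH[OF step.prems] by (cases "snd u = a") (metis fun_upd_same, metis fun_upd_other)
qed simp

lemma fixed_start:
  assumes "step\<^sup>*\<^sup>* s t" "state s" "g \<notin> moved s"
  shows "fst t g = fst s g"
  using start_steps[OF assms(1,2), of g] assms(3) by (auto simp: moved_def)

end

section \<open>The process when no placement exists\<close>

locale stuck_weighted_matroid = weighted_matroid +
  assumes no_placement: "\<not> (\<exists>\<phi>. \<forall>x. indep {e \<in> E. (x - \<phi> e) mod D < w e})"
begin

lemma tip_dependent:
  assumes "state s"
  shows "\<not> indep (insert (snd s) (layer s (tip s)))"
proof
  assume *: "indep (insert (snd s) (layer s (tip s)))"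
  have "indep {e \<in> E. (x - fst s e) mod D < w e}" for x
    using full_layer[OF assms, of x] assms * layer_cong[of x "tip s" s]
    by (auto simp: state_def)
  then show False using no_placement by blast
qed

text \<open>If no member of the fundamental circuit started at the tip, the whole circuit would lie in
  the independent layer just before it.\<close>

lemma step_exists:
  assumes s: "state s"
  shows "\<exists>t. step s t"
proof -
  let ?p = "snd s" and ?z = "tip s"
  have pE: "?p \<in> E" and wp: "1 \<le> w ?p" and ind: "indep (layer s x)" for x
    using s by (auto simp: state_def)
  obtain C where C: "C \<subseteq> insert ?p (layer s ?z)" "\<not> indep C"
    "\<And>f. f \<in> C \<Longrightarrow> indep (insert ?p (layer s ?z) - {f})"
    using fundamental_circuit[OF ind tip_dependent[OF s]] by metis
  have "\<exists>f\<in>C. fst s f mod D = ?z mod D"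
  proof (rule ccontr)
    assume none: "\<not> ?thesis"
    have "C \<subseteq> layer s (?z - 1)"
    proof
      fix e assume e: "e \<in> C"
      then have "fst s e mod D \<noteq> ?z mod D" using none by blast
      then have ne: "(?z - fst s e) mod D \<noteq> 0"
        using mod_diff_eq_iff[of 0 D ?z "fst s e"] D_pos by simp
      \<comment> \<open>For \<open>e = ?p\<close> the offset drops from \<open>w ?p - 1\<close>,
        just beyond the incomplete arc, to a value inside it.\<close>
      have "(?z - 1 - fst s e) mod D = (?z - fst s e) mod D - 1"
        using mod_diff_Suc[OF D_pos, of ?z "fst s e"] ne by (simp add: algebra_simps)
      then show "e \<in> layer s (?z - 1)"
        using e C(1) pE at_tip_iff[OF s, of ?z] by (auto simp: layer_def)
    qed
    then show False using C(2) ind indep_mono by blast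
  qed
  then show ?thesis using C step.intros by blast
qed

end

section \<open>Recurrent states and the final count\<close>

locale recurrent_state = stuck_weighted_matroid +
  fixes s :: "('a \<Rightarrow> int) \<times> 'a"
  assumes state_s: "state s"
    and recurrent: "step\<^sup>*\<^sup>* s t \<Longrightarrow> moved t = moved s"
begin

abbreviation reachable where "reachable \<equiv> step\<^sup>*\<^sup>* s"

lemma reachable_state: "reachable t \<Longrightarrow> state t"
  using state_steps state_s by blast

lemma snd_reachable: "reachable t \<Longrightarrow> snd t \<in> moved s"
  unfolding moved_def by blast

text \<open>If the next step shifts another element, recurrence makes \<open>a\<close> incomplete
  again later. The last step before that shifts \<open>a\<close>, and \<open>start_steps\<close>
  finds the first such shift.\<close>

lemma advance:
  assumes t: "reachable t" "snd t = a"
  shows "\<exists>u. reachable u \<and> snd u = a \<and> fst u a = fst t a + 1"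
proof -
  obtain t' where t': "step t t'"
    using step_exists reachable_state t by blast
  have rt': "reachable t'" using t t' by simp
  have eq: "fst t' = (fst t)(snd t' := fst t (snd t') + 1)"
    using step_elim(3) reachable_state t t' by blast
  show ?thesis
  proof (cases "snd t' = a")
    case True
    then show ?thesis using eq rt' by (intro exI[of _ t']) auto
  next
    case False
    then have same: "fst t' a = fst t a" using eq by simp
    have "a \<in> moved t'" using recurrent[OF rt'] snd_reachable t by blast
    then obtain u where u: "step\<^sup>*\<^sup>* t' u" "snd u = a" by (auto simp: moved_def)
    then have "t' \<noteq> u" using False by blast
    then obtain v where v: "step\<^sup>*\<^sup>* t' v" "step v u"
      using u(1) by (metis rtranclp.cases)
    have rv: "reachable v" using rt' v(1) by (meson rtranclp_trans)
    have "fst u a = fst v a + 1"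
      using step_elim(3)[OF reachable_state[OF rv] v(2)] u(2) by simp
    moreover have "reachable u" using rv v(2) by simp
    ultimately show ?thesis
      using start_steps[OF v(1) reachable_state[OF rt'], of a] same u(2) rt'
      by (metis rtranclp_trans)
  qed
qed

text \<open>While \<open>a\<close> is incomplete its tip is at a fixed distance from its start, so
  repeated advances reach every residue.\<close>

lemma visits:
  assumes a: "a \<in> moved s"
  obtains u where "reachable u" "snd u = a" "tip u mod D = x mod D"
proof -
  obtain t where t: "reachable t" "snd t = a" using a by (auto simp: moved_def)
  have *: "\<exists>u. reachable u \<and> snd u = a \<and> fst u a = fst t a + int n" for n
  proof (induction n)
    case 0
    show ?case using t by (intro exI[of _ t]) simp
  next
    case (Suc n)
    then obtain u where "reachable u" "snd u = a" "fst u a = fst t a + int n" by blast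
    then show ?case using advance[of u a] by (auto simp: algebra_simps)
  qed
  have "0 \<le> (x - tip t) mod D" using D_pos by simp
  then obtain u where u: "reachable u" "snd u = a" "fst u a = fst t a + (x - tip t) mod D"
    using *[of "nat ((x - tip t) mod D)"] by auto
  have "tip u = tip t + (x - tip t) mod D" using u t by (simp add: tip_def)
  then have "tip u mod D = x mod D" by (simp add: mod_simps)
  then show thesis using that u by blast
qed

text \<open>Within the restriction to \<open>X\<close> every step is a basis exchange, so the spans of the layers do
  not change over time; and each moved element is dependent on every layer at some time.\<close>

lemma moved_subset_span:
  assumes X: "moved s \<subseteq> X"
    and dep: "\<And>u. reachable u \<Longrightarrow> tip u mod D = x mod D \<Longrightarrow>
      \<not> indep (insert (snd u) (X \<inter> layer u x))"
    and t: "reachable t"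
  shows "moved s \<subseteq> matroid_span (X \<inter> layer t x)"
proof -
  have ind: "indep (X \<inter> layer u x)" if "reachable u" for u
    using reachable_state[OF that] indep_mono[of "layer u x"] by (simp add: state_def)
  have inv: "matroid_span (X \<inter> layer u x) = matroid_span (X \<inter> layer s x)" if "reachable u" for u
    using that
  proof (induction rule: rtranclp_induct)
    case (step u v)
    have su: "state u" using reachable_state step by blast
    have rv: "reachable v" using step by simp
    show ?case
    proof (cases "x mod D = tip u mod D")
      case True
      have uX: "snd u \<in> X" and vX: "snd v \<in> X"
        using X snd_reachable step.hyps(1) rv by blast+
      have lay: "layer v x = insert (snd u) (layer u x) - {snd v}"
        using layer_step[OF su step.hyps(2), of x] True by simp
      have eq: "X \<inter> layer v x = insert (snd u) (X \<inter> layer u x) - {snd v}"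
        using lay uX by blast
      have "snd v \<in> insert (snd u) (X \<inter> layer u x)"
        using step_elim(1)[OF su step.hyps(2)] layer_cong[OF True] vX by auto
      moreover have "snd u \<in> E" using su by (simp add: state_def)
      ultimately have "matroid_span (X \<inter> layer v x) = matroid_span (X \<inter> layer u x)"
        unfolding eq using ind[OF rv] eq True dep[OF step.hyps(1)] ind[OF step.hyps(1)]
        by (intro span_exchange) auto
      then show ?thesis using step.IH by simp
    next
      case False
      then show ?thesis using layer_step[OF su step.hyps(2), of x] step.IH by simp
    qed
  qed simp
  show ?thesis
  proof
    fix a assume a: "a \<in> moved s"
    obtain u where u: "reachable u" "snd u = a" "tip u mod D = x mod D"
      using visits[OF a] by metis
    then have "a \<in> matroid_span (X \<inter> layer u x)"
      using dep[OF u(1,3)] moved_subset[OF state_s] a by (auto simp: matroid_span_def)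
    then show "a \<in> matroid_span (X \<inter> layer t x)" using inv[OF u(1)] inv[OF t] by simp
  qed
qed

text \<open>Induction on the offset \<open>k\<close> of the tip inside the arc of \<open>g\<close>. At offset \<open>0\<close> an exchangeable \<open>g\<close>
  could be moved. At offset \<open>k + 1\<close> the fundamental circuit minus \<open>g\<close> consists of moved elements
  and of unmoved ones already present one point earlier; by the induction hypothesis the
  previous layer without \<open>g\<close> spans all of them and hence \<open>g\<close>, contradicting independence.\<close>

lemma unmoved_not_exchangeable:
  assumes g: "g \<in> E" "g \<notin> moved s"
  shows "int k < w g \<Longrightarrow> reachable t \<Longrightarrow> tip t mod D = (fst s g + int k) mod D \<Longrightarrow>
    \<not> indep (insert (snd t) (layer t (tip t)) - {g})"
proof (induction k arbitrary: t)
  case 0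
  show ?case
  proof
    assume i: "indep (insert (snd t) (layer t (tip t)) - {g})"
    have fg: "fst t g = fst s g" using fixed_start state_s g 0 by blast
    then have z: "(tip t - fst t g) mod D = 0"
      using 0 by (simp add: mod_eq_dvd_iff)
    have "g \<noteq> snd t" using g snd_reachable 0 by blast
    then have "g \<in> layer t (tip t)" using 0 z g by (simp add: layer_def)
    then have "step t ((fst t)(g := fst t g + 1), g)"
      using i 0 fg by (intro step.intros) auto
    then have "reachable ((fst t)(g := fst t g + 1), g)" using 0 by (meson rtranclp.rtrancl_into_rtrancl)
    then show False using snd_reachable g by fastforce
  qed
next
  case (Suc k)
  let ?p = "snd t" and ?x = "tip t" and ?K = "(E - {g}) \<inter> layer t (tip t - 1)"
  show ?case
  proof
    assume i: "indep (insert ?p (layer t ?x) - {g})"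
    have st: "state t" using reachable_state Suc by blast
    have ind: "indep (layer t x)" for x using st by (simp add: state_def)
    have tipk: "(tip t - 1) mod D = (fst s g + int k) mod D"
      using Suc.prems(3) by (simp add: mod_eq_dvd_iff algebra_simps)
    have mK: "moved s \<subseteq> matroid_span ?K"
    proof (rule moved_subset_span)
      \<comment> \<open>Only \<open>g\<close> is dropped, because the unmoved members of the circuit
        below must remain available in \<open>?K\<close>.\<close>
      show "moved s \<subseteq> E - {g}" using moved_subset[OF state_s] g by blast
      show "reachable t" by fact
      fix u assume u: "reachable u" "tip u mod D = (tip t - 1) mod D"
      have "\<not> indep (insert (snd u) (layer u (tip u)) - {g})"
        using Suc.IH[OF _ u(1)] u(2) tipk Suc.prems(1) by simp
      moreover have "insert (snd u) ((E - {g}) \<inter> layer u (tip t - 1)) = insert (snd u) (layer u (tip u)) - {g}"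
        using layer_cong[OF u(2), of u] snd_reachable[OF u(1)] g by (auto simp: layer_def)
      ultimately show "\<not> indep (insert (snd u) ((E - {g}) \<inter> layer u (tip t - 1)))" by simp
    qed
    have indK: "indep ?K" using indep_mono ind by blast
    obtain C where C: "C \<subseteq> insert ?p (layer t ?x)" "\<not> indep C"
      "\<And>f. f \<in> C \<Longrightarrow> indep (C - {f})" "\<And>f. f \<in> C \<Longrightarrow> indep (insert ?p (layer t ?x) - {f})"
      using fundamental_circuit[OF ind tip_dependent[OF st]] by metis
    have gC: "g \<in> C" using i C(1,2) indep_mono[of "insert ?p (layer t ?x) - {g}" C] by blast
    have "C - {g} \<subseteq> matroid_span ?K"
    proof
      fix e assume e: "e \<in> C - {g}"
      show "e \<in> matroid_span ?K"
      proof (cases "e \<in> moved s")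
        case True
        then show ?thesis using mK by blast
      next
        case False
        then have ep: "e \<noteq> ?p" using snd_reachable Suc.prems by blast
        then have el: "e \<in> layer t ?x" using e C(1) by blast
        \<comment> \<open>As a member of the circuit, \<open>e\<close> is exchangeable; starting at
          the tip, it would be moved.\<close>
        have "fst t e mod D \<noteq> ?x mod D"
        proof
          assume "fst t e mod D = ?x mod D"
          then have "step t ((fst t)(e := fst t e + 1), e)"
            using C(4)[of e] e el by (intro step.intros) auto
          then have "reachable ((fst t)(e := fst t e + 1), e)"
            using Suc.prems(2) by (meson rtranclp.rtrancl_into_rtrancl)
          then show False using snd_reachable False by fastforce
        qed
        then have "(?x - fst t e) mod D \<noteq> 0"
          using mod_diff_eq_iff[of 0 D ?x "fst t e"] D_pos by simp
        then have "(?x - 1 - fst t e) mod D = (?x - fst t e) mod D - 1"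
          using mod_diff_Suc[OF D_pos, of ?x "fst t e"] by (simp add: algebra_simps)
        then have "e \<in> ?K" using el ep e by (auto simp: layer_def)
        then show ?thesis using subset_span[OF indK] by blast
      qed
    qed
    then have "matroid_span (C - {g}) \<subseteq> matroid_span ?K"
      using span_subset_span indK C(3)[OF gC] by blast
    moreover have "g \<in> matroid_span (C - {g})"
      using C(2) gC g by (simp add: matroid_span_def insert_absorb)
    ultimately have "\<not> indep (insert g ?K)" by (auto simp: matroid_span_def)
    moreover have "g \<in> layer t (tip t - 1)"
    proof -
      have "fst t g = fst s g" using fixed_start state_s g Suc.prems by blast
      moreover have "g \<noteq> ?p" using snd_reachable g Suc.prems by blast
      moreover have "(tip t - 1 - fst s g) mod D = int k"
        using mod_diff_eq_iff[of "int k" D "tip t - 1" "fst s g"] tipk Suc.prems(1) w_le_D[OF g(1)]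
        by simp
      ultimately show ?thesis using g Suc.prems(1) by (simp add: layer_def)
    qed
    then have "insert g ?K \<subseteq> layer t (tip t - 1)" by blast
    ultimately show False using ind indep_mono by blast
  qed
qed

text \<open>All members of the fundamental circuit are exchangeable, so
  \<open>unmoved_not_exchangeable\<close>, at their offsets from the tip, leaves only moved ones.
  This supplies the dependence that \<open>moved_subset_span\<close> requires for the restriction to
  \<open>moved s\<close>.\<close>

lemma tip_dependent_moved:
  assumes "reachable u"
  shows "\<not> indep (insert (snd u) (moved s \<inter> layer u (tip u)))"
proof -
  have su: "state u" using reachable_state assms by blast
  then have ind: "indep (layer u (tip u))" by (simp add: state_def)
  obtain C where C: "C \<subseteq> insert (snd u) (layer u (tip u))" "\<not> indep C"
    "\<And>f. f \<in> C \<Longrightarrow> indep (insert (snd u) (layer u (tip u)) - {f})"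
    using fundamental_circuit[OF ind tip_dependent[OF su]] by metis
  have "C \<subseteq> moved s"
  proof (rule ccontr)
    assume "\<not> C \<subseteq> moved s"
    then obtain g where g: "g \<in> C" "g \<notin> moved s" by blast
    then have "g \<noteq> snd u" using snd_reachable[OF assms] by blast
    then have gl: "g \<in> layer u (tip u)" "g \<noteq> snd u" using C(1) g(1) by auto
    have gE: "g \<in> E" using gl by (simp add: layer_def)
    have fg: "fst u g = fst s g" using fixed_start state_s g assms by blast
    define j where "j = (tip u - fst s g) mod D"
    have j: "0 \<le> j" "j < w g" using gl fg D_pos by (auto simp: layer_def j_def)
    have "tip u mod D = (fst s g + int (nat j)) mod D"
      using j(1) by (simp add: j_def mod_simps)
    then show False
      using unmoved_not_exchangeable[OF gE g(2), of "nat j" u] C(3)[OF g(1)] j assms by simp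
  qed
  then have "C \<subseteq> insert (snd u) (moved s \<inter> layer u (tip u))" using C(1) by blast
  then show ?thesis using C(2) indep_mono by blast
qed

lemma contradiction: False
proof -
  let ?A = "moved s"
  have AE: "?A \<subseteq> E" using moved_subset state_s by blast
  then have finA: "finite ?A" using finite_ground finite_subset by blast
  have ind: "indep (?A \<inter> layer s x)" for x
    using state_s indep_mono[of "layer s x"] by (simp add: state_def)
  have sp: "?A \<subseteq> matroid_span (?A \<inter> layer s x)" for x
  proof (rule moved_subset_span)
    fix u assume u: "reachable u" "tip u mod D = x mod D"
    show "\<not> indep (insert (snd u) (?A \<inter> layer u x))"
      using tip_dependent_moved[OF u(1)] layer_cong[OF u(2), of u] by simp
  qed simp_all
  obtain I where I: "I \<subseteq> ?A" "indep I" "card I = matroid_rank indep ?A"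
    using rank_attained[OF finA] .
  have rank: "matroid_rank indep ?A \<le> card (?A \<inter> layer s x)" for x
    using card_le_card_of_subset_span[OF ind I(2)] I sp by (metis subset_trans)
  let ?v = "\<lambda>e. if e = snd s then w e - 1 else w e"
  have snd: "snd s \<in> ?A" using snd_reachable by blast
  have "D * int (matroid_rank indep ?A) = (\<Sum>x\<in>{0..<D}. int (matroid_rank indep ?A))"
    using D_pos by simp
  also have "\<dots> \<le> (\<Sum>x\<in>{0..<D}. int (card (?A \<inter> layer s x)))"
    using rank by (intro sum_mono) simp
  also have "\<dots> = (\<Sum>x\<in>{0..<D}. \<Sum>e\<in>?A. if e \<in> layer s x then 1 else 0)"
    using finA by (simp add: sum.If_cases)
  also have "\<dots> = (\<Sum>e\<in>?A. \<Sum>x\<in>{0..<D}. if e \<in> layer s x then 1 else 0)"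
    by (rule sum.swap)
  also have "\<dots> = (\<Sum>e\<in>?A. int (card {x \<in> {0..<D}. (x - fst s e) mod D < ?v e}))"
  proof (rule sum.cong[OF refl])
    fix e assume "e \<in> ?A"
    then have "{x \<in> {0..<D}. (x - fst s e) mod D < ?v e} = {0..<D} \<inter> {x. e \<in> layer s x}"
      using AE by (auto simp: layer_def)
    then show "(\<Sum>x\<in>{0..<D}. if e \<in> layer s x then 1 else 0)
        = int (card {x \<in> {0..<D}. (x - fst s e) mod D < ?v e})"
      by (simp add: sum.If_cases)
  qed
  also have "\<dots> \<le> (\<Sum>e\<in>?A. ?v e)"
    using AE w_nonneg state_s by (intro sum_mono card_residues_le D_pos) (auto simp: state_def)
  \<comment> \<open>The missing unit belongs to \<open>snd s\<close>, a member of \<open>?A\<close>;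
    this makes the count strict.\<close>
  also have "\<dots> = sum w ?A - 1"
    using finA snd by (simp add: sum.remove[of ?A "snd s"])
  finally show False using weight_le_rank[OF AE] by linarith
qed

end

section \<open>Integral placements by induction on the total weight\<close>

context weighted_matroid
begin

lemma state_imp_placement:
  assumes "state s"
  shows "\<exists>\<phi>. \<forall>x. indep {e \<in> E. (x - \<phi> e) mod D < w e}"
proof (rule ccontr)
  assume no: "\<not> ?thesis"
  obtain t where t: "state t" "\<And>u. step\<^sup>*\<^sup>* t u \<Longrightarrow> moved u = moved t"
    using exists_recurrent[OF assms] by metis
  interpret recurrent_state E indep w D t
    by unfold_locales (fact no, fact t(1), fact t(2))
  show False by (rule contradiction)
qed

end

text \<open>Lowering one weight keeps the rank bounds, and a placement of the lowered weights is a
  state for the original ones, with \<open>p\<close> incomplete.\<close>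

lemma (in matroid) integral_placement:
  fixes w :: "'a \<Rightarrow> int" and D :: int
  assumes "D > 0"
    and "\<And>e. e \<in> E \<Longrightarrow> 0 \<le> w e"
    and "\<And>A. A \<subseteq> E \<Longrightarrow> sum w A \<le> D * int (matroid_rank indep A)"
  shows "\<exists>\<phi>. \<forall>x. indep {e \<in> E. (x - \<phi> e) mod D < w e}"
  using assms(2,3)
proof (induction "nat (sum w E)" arbitrary: w rule: less_induct)
  case less
  interpret weighted_matroid E indep w D
    using assms(1) less.prems by unfold_locales
  show ?case
  proof (cases "\<exists>p\<in>E. 1 \<le> w p")
    case False
    then have "w e = 0" if "e \<in> E" for e
      using less.prems(1)[OF that] that by force
    moreover have "\<not> y mod D < 0" for y
      using assms(1) by (simp add: not_less)
    ultimately have "{e \<in> E. (x - 0) mod D < w e} = {}" for x by auto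
    then show ?thesis using indep_empty by (intro exI[of _ "\<lambda>_. 0"]) (simp only: simp_thms)
  next
    case True
    then obtain p where p: "p \<in> E" "1 \<le> w p" by blast
    let ?v = "w(p := w p - 1)"
    have le: "sum ?v A \<le> sum w A" for A by (intro sum_mono) simp
    have "sum ?v E < sum w E"
      using p finite_ground by (intro sum_strict_mono_ex1) auto
    moreover have "0 \<le> sum ?v E"
      using p less.prems(1) by (intro sum_nonneg) auto
    ultimately have "nat (sum ?v E) < nat (sum w E)" by simp
    moreover have "0 \<le> ?v e" if "e \<in> E" for e
      using p(2) less.prems(1)[OF that] by simp
    moreover have "sum ?v A \<le> D * int (matroid_rank indep A)" if "A \<subseteq> E" for A
      using le less.prems(2)[OF that] by (rule order_trans)
    ultimately have "\<exists>\<phi>. \<forall>x. indep {e \<in> E. (x - \<phi> e) mod D < ?v e}"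
      by (rule less.hyps)
    then obtain \<phi> where \<phi>: "\<And>x. indep {e \<in> E. (x - \<phi> e) mod D < ?v e}"
      by blast
    have "layer (\<phi>, p) x = {e \<in> E. (x - \<phi> e) mod D < ?v e}" for x
      by (auto simp: layer_def)
    then have "state (\<phi>, p)" using p \<phi> by (simp add: state_def)
    then show ?thesis by (rule state_imp_placement)
  qed
qed

section \<open>Rational weights and the real circle\<close>

lemma rat_common_denominator:
  fixes S :: "rat set"
  assumes "finite S"
  shows "\<exists>m::int. m > 0 \<and> (\<forall>q\<in>S. of_int m * q \<in> \<int>)"
  using assms
proof (induction rule: finite_induct)
  case (insert q S)
  then obtain m :: int where m: "m > 0" "\<And>q. q \<in> S \<Longrightarrow> of_int m * q \<in> \<int>" by blast
  obtain a b where q: "q = Fract a b" "b > 0" by (cases q)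
  then have bq: "of_int b * q = of_int a" by (simp add: Fract_of_int_quotient)
  have "of_int (m * b) * r \<in> \<int>" if "r \<in> insert q S" for r
  proof (cases "r = q")
    case True
    have "of_int (m * b) * q = of_int m * of_int a"
      using bq by (simp add: mult.assoc)
    then show ?thesis using True by (metis Ints_of_int of_int_mult)
  next
    case False
    then have "of_int b * (of_int m * r) \<in> \<int>" using Ints_mult[OF Ints_of_int m(2)] that by auto
    then show ?thesis by (simp add: mult_ac)
  qed
  then show ?case using m(1) q(2) by (intro exI[of _ "m * b"]) auto
qed (auto intro: exI[of _ 1])

definition circle_point :: "real \<Rightarrow> real \<Rightarrow> real set" where
  "circle_point d u = {v. [u = v] (rmod d)}"

lemma circle_eq_range: "circle d = range (circle_point d)"
  by (auto simp: circle_def quotient_def circle_point_def Image_def)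

text \<open>Both representatives vary by multiples of \<open>d\<close>, but only the difference of
  the two multiples matters.\<close>

lemma circle_point_in_cyclic_arc_iff:
  "circle_point d u \<in> cyclic_arc d (circle_point d c) l \<longleftrightarrow>
    (\<exists>n::int. c + of_int n * d \<le> u \<and> u < c + of_int n * d + l)"
proof -
  have "circle_point d u \<in> cyclic_arc d (circle_point d c) l \<longleftrightarrow>
      (\<exists>i j :: int. c + of_int i * d \<le> u + of_int j * d \<and> u + of_int j * d < c + of_int i * d + l)"
    by (auto simp: cyclic_arc_def circle_eq_range circle_point_def rcong_altdef)
  also have "\<dots> \<longleftrightarrow> (\<exists>n::int. c + of_int n * d \<le> u \<and> u < c + of_int n * d + l)"
  proof
    assume "\<exists>i j :: int. c + of_int i * d \<le> u + of_int j * d \<and> u + of_int j * d < c + of_int i * d + l"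
    then obtain i j :: int where
      "c + of_int i * d \<le> u + of_int j * d" "u + of_int j * d < c + of_int i * d + l" by blast
    then show "\<exists>n::int. c + of_int n * d \<le> u \<and> u < c + of_int n * d + l"
      by (intro exI[of _ "i - j"]) (simp add: algebra_simps)
  next
    assume "\<exists>n::int. c + of_int n * d \<le> u \<and> u < c + of_int n * d + l"
    then obtain n :: int where "c + of_int n * d \<le> u" "u < c + of_int n * d + l" by blast
    then show "\<exists>i j :: int. c + of_int i * d \<le> u + of_int j * d \<and> u + of_int j * d < c + of_int i * d + l"
      by (intro exI[of _ n] exI[of _ 0]) simp
  qed
  finally show ?thesis .
qed

lemma cyclic_arc_measure:
  assumes d: "0 < d" and l: "0 \<le> l" "l \<le> d" and p: "p \<in> circle d"
  obtains T where "T \<in> sets lborel" "T \<subseteq> {0..<d}" "measure lborel T = l"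
    "\<And>u. u \<in> T \<Longrightarrow> circle_point d u \<in> cyclic_arc d p l"
proof -
  obtain c' where c': "p = circle_point d c'" using p by (auto simp: circle_eq_range)
  define c where "c = c' rmod d"
  have p_eq: "p = circle_point d c" by (simp add: c' c_def circle_point_def)
  have c: "0 \<le> c" "c < d" using d by (auto simp: c_def rmod_nonneg rmod_less)
  have arc: "circle_point d u \<in> cyclic_arc d p l"
    if "c \<le> u \<and> u < c + l \<or> c - d \<le> u \<and> u < c - d + l" for u
    unfolding p_eq circle_point_in_cyclic_arc_iff
    using that by (auto intro: exI[of _ 0] exI[of _ "- 1"])
  \<comment> \<open>The lifted arc is cut at \<open>d\<close> and its overshoot reappears at 0;
    \<open>l <= d\<close> keeps the two pieces disjoint.\<close>
  define T where "T = {c..<min d (c + l)} \<union> {0..<max 0 (c + l - d)}"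
  have "measure lborel T = measure lborel {c..<min d (c + l)} + measure lborel {0..<max 0 (c + l - d)}"
    unfolding T_def using c l by (intro measure_Un3[THEN trans]) (auto simp: fmeasurable_def)
  also have "\<dots> = l" using c l by (auto simp: min_def max_def)
  finally have "measure lborel T = l" .
  moreover have "T \<subseteq> {0..<d}" using c l d by (auto simp: T_def)
  moreover have "circle_point d u \<in> cyclic_arc d p l" if "u \<in> T" for u
    using that c l by (intro arc) (auto simp: T_def)
  moreover have "T \<in> sets lborel" by (simp add: T_def)
  ultimately show thesis using that by blast
qed

text \<open>The bound by \<open>d\<close> on single weights lets each arc contribute its full weight
  to the integral: a longer interval would cover the circle only once.\<close>

lemma (in matroid) weight_le_rank_of_placement:
  assumes d: "d > 0"
    and w: "\<And>e. e \<in> E \<Longrightarrow> 0 \<le> \<omega> e" "\<And>e. e \<in> E \<Longrightarrow> \<omega> e \<le> d"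
    and \<phi>: "\<phi> \<in> E \<rightarrow> circle (of_rat d)"
    and indep: "\<And>x. x \<in> circle (of_rat d) \<Longrightarrow> indep (active_elements E \<omega> d \<phi> x)"
    and A: "A \<subseteq> E"
  shows "sum \<omega> A \<le> d * of_nat (matroid_rank indep A)"
proof -
  let ?d = "of_rat d :: real" and ?r = "matroid_rank indep A"
  have finA: "finite A" using A finite_ground finite_subset by blast
  have "\<exists>T. T \<in> sets lborel \<and> T \<subseteq> {0..<?d} \<and> measure lborel T = of_rat (\<omega> a) \<and>
      (\<forall>u\<in>T. circle_point ?d u \<in> cyclic_arc ?d (\<phi> a) (of_rat (\<omega> a)))" if "a \<in> A" for a
  proof -
    have aE: "a \<in> E" using that A by blast
    have "0 < ?d" "0 \<le> (of_rat (\<omega> a) :: real)" "of_rat (\<omega> a) \<le> ?d" "\<phi> a \<in> circle ?d"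
      using d w[OF aE] \<phi> aE by (auto simp: of_rat_less_eq)
    from cyclic_arc_measure[OF this] show ?thesis by metis
  qed
  then obtain T where T: "\<And>a. a \<in> A \<Longrightarrow> T a \<in> sets lborel" "\<And>a. a \<in> A \<Longrightarrow> T a \<subseteq> {0..<?d}"
    "\<And>a. a \<in> A \<Longrightarrow> measure lborel (T a) = of_rat (\<omega> a)"
    "\<And>a u. a \<in> A \<Longrightarrow> u \<in> T a \<Longrightarrow> circle_point ?d u \<in> cyclic_arc ?d (\<phi> a) (of_rat (\<omega> a))"
    by metis
  have fin: "emeasure lborel (T a) < \<infinity>" if "a \<in> A" for a
  proof -
    have "emeasure lborel (T a) \<le> emeasure lborel {0..<?d}"
      using T(2)[OF that] by (intro emeasure_mono) auto
    also have "\<dots> < \<infinity>" using d by simp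
    finally show ?thesis .
  qed
  have int: "integrable lborel (indicator (T a) :: real \<Rightarrow> real)" if "a \<in> A" for a
    using T(1)[OF that] fin[OF that] by (intro integrable_real_indicator)
  have "of_rat (sum \<omega> A) = (\<Sum>a\<in>A. measure lborel (T a))"
    using T(3) by (simp add: of_rat_sum)
  also have "\<dots> = (\<Sum>a\<in>A. \<integral>u. indicator (T a) u \<partial>lborel)"
    using T(1) by simp
  also have "\<dots> = (\<integral>u. (\<Sum>a\<in>A. indicator (T a) u) \<partial>lborel)"
    using int by (intro Bochner_Integration.integral_sum[symmetric])
  also have "\<dots> \<le> (\<integral>u. real ?r * indicator {0..<?d} u \<partial>lborel)"
  proof (rule integral_mono)
    show "integrable lborel (\<lambda>u. \<Sum>a\<in>A. indicator (T a) u :: real)"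
      using int by (rule Bochner_Integration.integrable_sum)
    show "integrable lborel (\<lambda>u. real ?r * indicator {0..<?d} u)"
      using d by (intro integrable_mult_right integrable_real_indicator) auto
    fix u :: real
    show "(\<Sum>a\<in>A. indicator (T a) u) \<le> real ?r * indicator {0..<?d} u"
    proof (cases "u \<in> {0..<?d}")
      case True
      let ?B = "{a \<in> A. u \<in> T a}"
      have "?B \<subseteq> active_elements E \<omega> d \<phi> (circle_point ?d u)"
        using A T(4) by (auto simp: active_elements_def)
      then have "indep ?B"
        using indep[of "circle_point ?d u"] indep_mono by (auto simp: circle_eq_range)
      then have "card ?B \<le> ?r" using finA by (intro card_le_rank) auto
      moreover have "(\<Sum>a\<in>A. indicator (T a) u :: real) = real (card ?B)"
        using finA by (simp add: indicator_def sum.If_cases Int_def)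
      ultimately show ?thesis using True by simp
    next
      case False
      then have "indicator (T a) u = (0 :: real)" if "a \<in> A" for a
        using T(2)[OF that] by (auto simp: indicator_def)
      then show ?thesis using False by simp
    qed
  qed
  also have "\<dots> = real ?r * ?d" using d by simp
  finally have "of_rat (sum \<omega> A) \<le> (of_rat (d * of_nat ?r) :: real)"
    by (simp add: of_rat_mult mult.commute)
  then show ?thesis by (simp only: of_rat_less_eq)
qed

text \<open>Scaling by a common denominator \<open>m\<close> puts all ends of arcs at integers, so
  the elements active at \<open>u\<close> already belong to the discrete layer at the floor of
  \<open>u * m\<close>.\<close>

lemma (in matroid) placement_of_weight_le_rank:
  assumes d: "d > 0"
    and w: "\<And>e. e \<in> E \<Longrightarrow> 0 \<le> \<omega> e"
    and rank: "\<And>A. A \<subseteq> E \<Longrightarrow> sum \<omega> A \<le> d * of_nat (matroid_rank indep A)"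
  shows "\<exists>\<phi> \<in> E \<rightarrow> circle (of_rat d).
    \<forall>x \<in> circle (of_rat d). indep (active_elements E \<omega> d \<phi> x)"
proof -
  let ?d = "of_rat d :: real"
  obtain m :: int where m: "m > 0" "\<And>q. q \<in> insert d (\<omega> ` E) \<Longrightarrow> of_int m * q \<in> \<int>"
    using rat_common_denominator[of "insert d (\<omega> ` E)"] finite_ground by auto
  define D where "D = \<lfloor>of_int m * d\<rfloor>"
  define v where "v e = \<lfloor>of_int m * \<omega> e\<rfloor>" for e
  have D: "of_int D = of_int m * d" using m(2) by (simp add: D_def)
  have v: "of_int (v e) = of_int m * \<omega> e" if "e \<in> E" for e
    using m(2) that by (simp add: v_def)
  have "D > 0"
    using D d m(1) by (metis mult_pos_pos of_int_0_less_iff)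
  have "\<exists>\<psi>. \<forall>x. indep {e \<in> E. (x - \<psi> e) mod D < v e}"
  proof (rule integral_placement)
    show "0 \<le> v e" if "e \<in> E" for e
      using w[OF that] m(1) by (simp add: v_def)
    show "sum v A \<le> D * int (matroid_rank indep A)" if A: "A \<subseteq> E" for A
    proof -
      have "of_int (sum v A) = (\<Sum>a\<in>A. of_int m * \<omega> a)"
        using v A by (simp add: subset_iff)
      also have "\<dots> = of_int m * sum \<omega> A" by (simp add: sum_distrib_left)
      also have "\<dots> \<le> of_int m * (d * of_nat (matroid_rank indep A))"
        using m(1) rank[OF A] by (intro mult_left_mono) auto
      also have "\<dots> = of_int (D * int (matroid_rank indep A))" by (simp add: D)
      finally show ?thesis by (simp only: of_int_le_iff)
    qed
  qed fact
  then obtain \<psi> where \<psi>: "\<And>x. indep {e \<in> E. (x - \<psi> e) mod D < v e}" by blast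
  define \<phi> where "\<phi> e = circle_point ?d (of_int (\<psi> e) / of_int m)" for e
  have rD: "real_of_int D = of_int m * ?d"
    using arg_cong[OF D, of "of_rat :: rat \<Rightarrow> real"] by (simp add: of_rat_mult)
  have "indep (active_elements E \<omega> d \<phi> x)" if x: "x \<in> circle ?d" for x
  proof -
    obtain u where u: "x = circle_point ?d u" using x by (auto simp: circle_eq_range)
    let ?k = "\<lfloor>u * of_int m\<rfloor>"
    have "active_elements E \<omega> d \<phi> x \<subseteq> {e \<in> E. (?k - \<psi> e) mod D < v e}"
    proof
      fix e assume "e \<in> active_elements E \<omega> d \<phi> x"
      then obtain n :: int where e: "e \<in> E"
        and n: "of_int (\<psi> e) / of_int m + of_int n * ?d \<le> u"
          "u < of_int (\<psi> e) / of_int m + of_int n * ?d + of_rat (\<omega> e)"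
        by (auto simp: active_elements_def \<phi>_def u circle_point_in_cyclic_arc_iff)
      have rv: "real_of_int (v e) = of_int m * of_rat (\<omega> e)"
        using arg_cong[OF v[OF e], of "of_rat :: rat \<Rightarrow> real"] by (simp add: of_rat_mult)
      have "real_of_int (\<psi> e + n * D) = (of_int (\<psi> e) / of_int m + of_int n * ?d) * of_int m"
        using m(1) by (simp add: rD field_simps)
      moreover have "real_of_int (\<psi> e + n * D + v e)
          = (of_int (\<psi> e) / of_int m + of_int n * ?d + of_rat (\<omega> e)) * of_int m"
        using m(1) by (simp add: rD rv field_simps)
      ultimately have "real_of_int (\<psi> e + n * D) \<le> u * of_int m"
          "u * of_int m < real_of_int (\<psi> e + n * D + v e)"
        using n m(1) by (simp_all del: of_int_add of_int_mult)
      \<comment> \<open>Rounding down respects half-open intervals with integer ends.\<close>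
      then have k: "\<psi> e + n * D \<le> ?k" "?k < \<psi> e + n * D + v e"
        by (simp_all only: le_floor_iff floor_less_iff)
      have "(?k - \<psi> e) mod D = (?k - \<psi> e - n * D) mod D"
        by (simp add: mod_eq_dvd_iff)
      also have "\<dots> \<le> ?k - \<psi> e - n * D"
        using k by (intro zmod_le_nonneg_dividend) simp
      also have "\<dots> < v e" using k by simp
      finally show "e \<in> {e \<in> E. (?k - \<psi> e) mod D < v e}" using e by simp
    qed
    then show ?thesis using \<psi> indep_mono by blast
  qed
  moreover have "\<phi> \<in> E \<rightarrow> circle ?d" by (auto simp: \<phi>_def circle_eq_range)
  ultimately show ?thesis by blast
qed

theorem theorem1p5:
  fixes E :: "'a set" and indep :: "'a set \<Rightarrow> bool" and \<omega> :: "'a \<Rightarrow> rat" and d :: rat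
  assumes "matroid E indep"
    and "loopless E indep"
    and "\<And>e. e \<in> E \<Longrightarrow> \<omega> e \<ge> 0"
    and "d > 0"
  shows "(\<exists>\<phi> \<in> E \<rightarrow> circle (of_rat d).
            (\<forall>e\<in>E. \<omega> e \<le> d) \<and>
            (\<forall>x \<in> circle (of_rat d). indep (active_elements E \<omega> d \<phi> x)))
         \<longleftrightarrow>
         (\<forall>A. A \<subseteq> E \<and> A \<noteq> {} \<longrightarrow>
            d \<ge> (\<Sum>a\<in>A. \<omega> a) / of_nat (matroid_rank indep A))"
    (is "?L \<longleftrightarrow> ?R")
proof -
  interpret matroid E indep by fact
  \<comment> \<open>Looplessness enters here: a loop has rank 0, and its quotient would be 0 because
    division by zero yields 0.\<close>
  have rank_pos: "0 < matroid_rank indep A" if A: "A \<subseteq> E" "A \<noteq> {}" for A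
  proof -
    obtain a where a: "a \<in> A" using A by blast
    have "indep {a}" using a A assms(2) by (auto simp: loopless_def)
    moreover have "finite A" using A finite_ground finite_subset by blast
    ultimately show ?thesis using card_le_rank[of "{a}" A] a by simp
  qed
  have iff: "sum \<omega> A / of_nat (matroid_rank indep A) \<le> d \<longleftrightarrow>
      sum \<omega> A \<le> d * of_nat (matroid_rank indep A)" if "A \<subseteq> E" "A \<noteq> {}" for A
    using rank_pos[OF that] by (simp add: divide_le_eq)
  show ?thesis
  proof
    assume ?L
    then obtain \<phi> where \<phi>: "\<phi> \<in> E \<rightarrow> circle (of_rat d)" "\<And>e. e \<in> E \<Longrightarrow> \<omega> e \<le> d"
      "\<And>x. x \<in> circle (of_rat d) \<Longrightarrow> indep (active_elements E \<omega> d \<phi> x)" by blast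
    have "sum \<omega> A \<le> d * of_nat (matroid_rank indep A)" if "A \<subseteq> E" for A
      using weight_le_rank_of_placement[OF assms(4,3) \<phi>(2,1,3) that] .
    then show ?R using iff by blast
  next
    assume R: ?R
    have rank: "sum \<omega> A \<le> d * of_nat (matroid_rank indep A)" if "A \<subseteq> E" for A
      using R iff[OF that] that assms(4) by (cases "A = {}") auto
    have "\<omega> e \<le> d" if e: "e \<in> E" for e
    proof -
      have "(of_nat (matroid_rank indep {e}) :: rat) \<le> 1"
        using rank_singleton_le by simp
      then have "d * of_nat (matroid_rank indep {e}) \<le> d * 1"
        using assms(4) by (intro mult_left_mono) auto
      then show ?thesis using rank[of "{e}"] e by simp
    qed
    then show ?L
      using placement_of_weight_le_rank[OF assms(4,3) rank] by blast
  qed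
qed

end
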